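(* Let $(\mathfrak g,[\cdot,\cdot,\cdot])$ be a $3$-Lie algebra and $(V;\rho,\nu)$ a generalized representation of $\mathfrak g$. Then $(\mathfrak g\oplus V,[\cdot,\cdot,\cdot]_{(\rho,\nu)})$ is a $3$-Lie algebra, where for $x,y,z\in\mathfrak g$, $u,v,w\in V$ $$[x+u,y+v,z+w]_{(\rho,\nu)}=[x,y,z]+\rho(x,y)(w)+\rho(y,z)(u)+\rho(z,x)(v)+\nu(x)(v\wedge w)+\nu(y)(w\wedge u)+\nu(z)(u\wedge v).$$
   Context: All vector spaces are over an algebraically closed field $\mathbb K$ of characteristic $0$. A $3$-Lie algebra is a vector space $\mathfrak g$ with a skew-symmetric trilinear map $[\cdot,\cdot,\cdot]:\otimes^3\mathfrak g\to\mathfrak g$ satisfying the Fundamental Identity: $[x_1,x_2,[x_3,x_4,x_5]]=[[x_1,x_2,x_3],x_4,x_5]+[x_3,[x_1,x_2,x_4],x_5]+[x_3,x_4,[x_1,x_2,x_5]]$ for all $x_i\in\mathfrak g$. Graded Lie algebra of a vector space $W$. For $p\ge 0$ let $C^p(W,W)$ be the space of linear maps $\alpha:(\wedge^2W)^{\otimes p}\otimes W\to W$ which (for $p\ge1$) are skew-symmetric in the last three arguments, i.e. linear maps on $\wedge^2W\otimes\cdots\otimes\wedge^2W\wedge W$ ($p$ factors $\wedge^2W$). For $\alpha\in C^p(W,W)$, $\beta\in C^q(W,W)$ put $[\alpha,\beta]^{\mathrm{3Lie}}=(-1)^{pq}\alpha\circ\beta-\beta\circ\alpha\in C^{p+q}(W,W)$.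 Here, for $\mathfrak X_i=x_i\wedge y_i\in\wedge^2W$ ($1\le i\le p+q$) and $x\in W$, $$\begin{aligned}\alpha\circ\beta(\mathfrak X_1,\ldots,\mathfrak X_{p+q},x)=&\sum_{J,\,j_{q+1}<p+q+1}(-1)^{(J,I)}(-1)^k\Big(\alpha(\mathfrak X_{i_1},\ldots,\mathfrak X_{i_k},\beta(\mathfrak X_{j_1},\ldots,\mathfrak X_{j_q},x_{j_{q+1}})\wedge y_{j_{q+1}},\mathfrak X_{i_{k+1}},\ldots,\mathfrak X_{i_{p-1}},x)\\&\quad+\alpha(\mathfrak X_{i_1},\ldots,\mathfrak X_{i_k},x_{j_{q+1}}\wedge\beta(\mathfrak X_{j_1},\ldots,\mathfrak X_{j_q},y_{j_{q+1}}),\mathfrak X_{i_{k+1}},\ldots,\mathfrak X_{i_{p-1}},x)\Big)\\&+\sum_{J,\,j_{q+1}=p+q+1}(-1)^{(J,I)}(-1)^p\alpha(\mathfrak X_{i_1},\ldots,\mathfrak X_{i_p},\beta(\mathfrak X_{j_1},\ldots,\mathfrak X_{j_q},x)),\end{aligned}$$ where $J=\{j_1<\cdots<j_{q+1}\}$ runs over the $(q+1)$-element subsets of $N=\{1,\ldots,p+q+1\}$, $I=\{i_1<\cdots<i_p\}=N\setminus J$, $(-1)^{(J,I)}$ is the sign of the permutation $(j_1,\ldots,j_{q+1},i_1,\ldots,i_p)$, and $k$ is determined by $i_k<j_{q+1}<i_{k+1}$ ($k=0$ if $j_{q+1}<i_1$, $k=p-1$ if $j_{q+1}>i_{p-1}$).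 This makes $\oplus_pC^p(W,W)$ a graded Lie algebra (known fact). Generalized representation. Take $W=\mathfrak g\oplus V$. Let $\pi$ be the bracket of $\mathfrak g$ extended by zero: $\pi(x+u,y+v,z+w)=[x,y,z]$. A generalized representation $(V;\rho,\nu)$ of $\mathfrak g$ on a vector space $V$ consists of linear maps $\rho:\wedge^2\mathfrak g\to\mathfrak{gl}(V)$ and $\nu:\mathfrak g\to\mathrm{Hom}(\wedge^2V,V)$ such that $[\pi+\bar\rho+\bar\nu,\pi+\bar\rho+\bar\nu]^{\mathrm{3Lie}}=0$, where $\bar\rho(x+u,y+v,z+w)=\rho(x,y)(w)+\rho(y,z)(u)+\rho(z,x)(v)$ and $\bar\nu(x+u,y+v,z+w)=\nu(x)(v\wedge w)+\nu(y)(w\wedge u)+\nu(z)(u\wedge v)$. *)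

theory Defs
  imports
    "HOL-Analysis.Product_Vector"
    "HOL-Combinatorics.Permutations"
    "HOL-Computational_Algebra.Polynomial"
begin

text \<open>
  Vector spaces are types with a scalar multiplication (locale \<^locale>\<open>vector_space\<close>) over an
  algebraically closed field of characteristic 0, of arbitrary dimension. Linear maps out of
  tensor and exterior products are represented, via the universal properties, by curried
  multilinear (and alternating) maps.
\<close>

definition trilinear ::
  "('k::field \<Rightarrow> 'a::ab_group_add \<Rightarrow> 'a) \<Rightarrow> ('k \<Rightarrow> 'b::ab_group_add \<Rightarrow> 'b) \<Rightarrow>
   ('k \<Rightarrow> 'c::ab_group_add \<Rightarrow> 'c) \<Rightarrow> ('k \<Rightarrow> 'd::ab_group_add \<Rightarrow> 'd) \<Rightarrow>
   ('a \<Rightarrow> 'b \<Rightarrow> 'c \<Rightarrow> 'd) \<Rightarrow> bool" where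
  "trilinear sa sb sc sd f \<longleftrightarrow>
     (\<forall>y z. Vector_Spaces.linear sa sd (\<lambda>x. f x y z)) \<and>
     (\<forall>x z. Vector_Spaces.linear sb sd (\<lambda>y. f x y z)) \<and>
     (\<forall>x y. Vector_Spaces.linear sc sd (\<lambda>z. f x y z))"

locale three_lie_algebra = vector_space scale
  for scale :: "'k::{alg_closed_field,field_char_0} \<Rightarrow> 'g::ab_group_add \<Rightarrow> 'g" +
  fixes bracket :: "'g \<Rightarrow> 'g \<Rightarrow> 'g \<Rightarrow> 'g"
  assumes trilinear_bracket: "trilinear scale scale scale scale bracket"
    and skew_12: "bracket y x z = - bracket x y z"
    and skew_23: "bracket x z y = - bracket x y z"
    and fundamental_identity:
      "bracket x1 x2 (bracket x3 x4 x5) =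
         bracket (bracket x1 x2 x3) x4 x5 + bracket x3 (bracket x1 x2 x4) x5
         + bracket x3 x4 (bracket x1 x2 x5)"


section \<open>The graded Lie algebra of a vector space\<close>

text \<open>
  An element of \<open>C\<^sup>p(W,W)\<close> is a function \<open>\<alpha>\<close> of a list of \<open>p\<close> pairs, where the pair \<open>(x, y)\<close>
  stands for \<open>x \<and> y\<close>, and of one more vector. It is set to 0 on lists of any other length, so
  that equality of cochains is equality of functions. In the last condition, swapping the last two
  of the final three arguments suffices: the alternation in the last pair gives the
  other transposition.
\<close>

type_synonym 'w cochain = "('w \<times> 'w) list \<Rightarrow> 'w \<Rightarrow> 'w"

definition cochains :: "('k::field \<Rightarrow> 'w::ab_group_add \<Rightarrow> 'w) \<Rightarrow> nat \<Rightarrow> 'w cochain set" where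
  "cochains s p = {\<alpha>.
     (\<forall>X x. length X \<noteq> p \<longrightarrow> \<alpha> X x = 0) \<and>
     (\<forall>X. length X = p \<longrightarrow> Vector_Spaces.linear s s (\<alpha> X)) \<and>
     (\<forall>X x i b. length X = p \<and> i < p \<longrightarrow>
        Vector_Spaces.linear s s (\<lambda>a. \<alpha> (X[i := (a, b)]) x)) \<and>
     (\<forall>X x i a. length X = p \<and> i < p \<longrightarrow>
        Vector_Spaces.linear s s (\<lambda>b. \<alpha> (X[i := (a, b)]) x)) \<and>
     (\<forall>X x i a. length X = p \<and> i < p \<longrightarrow> \<alpha> (X[i := (a, a)]) x = 0) \<and>
     (\<forall>X a b x. Suc (length X) = p \<longrightarrow> \<alpha> (X @ [(a, b)]) x = - \<alpha> (X @ [(a, x)]) b)}"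

text \<open>
  All indices are shifted to start from 0: \<open>N = {..p + q}\<close>, the list entries are
  \<open>X ! 0, \<dots>, X ! (p + q - 1)\<close>, and the index \<open>p + q\<close> belongs to the last argument \<open>x\<close>.
  For a subset \<open>J = {j\<^sub>1 < \<dots> < j\<^bsub>q+1\<^esub>}\<close> of \<open>N\<close> with complement \<open>I = {i\<^sub>1 < \<dots> < i\<^sub>p}\<close>, the following
  is the permutation \<open>(j\<^sub>1, \<dots>, j\<^bsub>q+1\<^esub>, i\<^sub>1, \<dots>, i\<^sub>p)\<close> of \<open>{..<n}\<close>, extended by the identity.
\<close>

definition unshuffle :: "nat \<Rightarrow> nat set \<Rightarrow> nat \<Rightarrow> nat" where
  "unshuffle n J m =
     (if m < n then (sorted_list_of_set J @ sorted_list_of_set ({..<n} - J)) ! m else m)"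

text \<open>
  In the first sum \<open>m = j\<^bsub>q+1\<^esub> < p + q\<close>, so that \<open>i\<^sub>p = p + q\<close> and \<open>Is\<close> lists the arguments
  with indices \<open>i\<^sub>1, \<dots>, i\<^bsub>p-1\<^esub>\<close>; the number \<open>k\<close> is determined by \<open>i\<^sub>k < m < i\<^bsub>k+1\<^esub>\<close>.
\<close>

definition cochain_comp ::
  "('k::field \<Rightarrow> 'w::ab_group_add \<Rightarrow> 'w) \<Rightarrow> nat \<Rightarrow> nat \<Rightarrow> 'w cochain \<Rightarrow> 'w cochain \<Rightarrow> 'w cochain" where
  "cochain_comp s p q \<alpha> \<beta> X x =
    (if length X = p + q then
      (\<Sum>J | J \<subseteq> {..p + q} \<and> card J = q + 1 \<and> Max J < p + q.
         let m = Max J;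
             Js = map ((!) X) (sorted_list_of_set (J - {m}));
             Is = map ((!) X) (sorted_list_of_set ({..<p + q} - J));
             k = card {i. i \<in> {..p + q} - J \<and> i < m};
             (a, b) = X ! m
         in s (of_int (sign (unshuffle (p + q + 1) J) * (-1) ^ k))
              (\<alpha> (take k Is @ [(\<beta> Js a, b)] @ drop k Is) x
               + \<alpha> (take k Is @ [(a, \<beta> Js b)] @ drop k Is) x))
      + (\<Sum>J | J \<subseteq> {..p + q} \<and> card J = q + 1 \<and> Max J = p + q.
         let Js = map ((!) X) (sorted_list_of_set (J - {p + q}));
             Is = map ((!) X) (sorted_list_of_set ({..p + q} - J))
         in s (of_int (sign (unshuffle (p + q + 1) J) * (-1) ^ p)) (\<alpha> Is (\<beta> Js x)))
     else 0)"

definition bracket_3Lie ::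
  "('k::field \<Rightarrow> 'w::ab_group_add \<Rightarrow> 'w) \<Rightarrow> nat \<Rightarrow> nat \<Rightarrow> 'w cochain \<Rightarrow> 'w cochain \<Rightarrow> 'w cochain" where
  "bracket_3Lie s p q \<alpha> \<beta> X x =
     s ((-1) ^ (p * q)) (cochain_comp s p q \<alpha> \<beta> X x) - cochain_comp s q p \<beta> \<alpha> X x"

definition cochain1 :: "('w \<Rightarrow> 'w \<Rightarrow> 'w \<Rightarrow> 'w::zero) \<Rightarrow> 'w cochain" where
  "cochain1 f X x = (case X of [(a, b)] \<Rightarrow> f a b x | _ \<Rightarrow> 0)"


section \<open>Generalized representations\<close>

text \<open>
  In the locale \<open>generalized_representation\<close> below, \<open>\<theta> = \<pi> + \<rho>\<close>-bar \<open>+ \<nu>\<close>-bar lies in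
  \<open>cochains (module_prod.scale sg sv) 1\<close>, as a consequence of the conditions on \<open>br\<close>, \<open>\<rho>\<close>, \<open>\<nu>\<close>
  preceding the equation \<open>[\<theta>, \<theta>] = 0\<close>, so this membership is not a separate assumption.
  The direct sum of \<open>\<gg>\<close> and \<open>V\<close> is the product type with the scalar multiplication
  \<^const>\<open>module_prod.scale\<close>.
\<close>

fun pi_ext :: "('g \<Rightarrow> 'g \<Rightarrow> 'g \<Rightarrow> 'g) \<Rightarrow> 'g \<times> 'v \<Rightarrow> 'g \<times> 'v \<Rightarrow> 'g \<times> 'v \<Rightarrow> 'g \<times> 'v::zero" where
  "pi_ext br (x, u) (y, v) (z, w) = (br x y z, 0)"

fun rho_bar ::
  "('g \<Rightarrow> 'g \<Rightarrow> 'v \<Rightarrow> 'v) \<Rightarrow> 'g \<times> 'v \<Rightarrow> 'g \<times> 'v \<Rightarrow> 'g \<times> 'v \<Rightarrow> 'g::zero \<times> 'v::plus" where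
  "rho_bar \<rho> (x, u) (y, v) (z, w) = (0, \<rho> x y w + \<rho> y z u + \<rho> z x v)"

fun nu_bar ::
  "('g \<Rightarrow> 'v \<Rightarrow> 'v \<Rightarrow> 'v) \<Rightarrow> 'g \<times> 'v \<Rightarrow> 'g \<times> 'v \<Rightarrow> 'g \<times> 'v \<Rightarrow> 'g::zero \<times> 'v::plus" where
  "nu_bar \<nu> (x, u) (y, v) (z, w) = (0, \<nu> x v w + \<nu> y w u + \<nu> z u v)"

locale generalized_representation =
  g: three_lie_algebra sg br + V: vector_space sv
  for sg :: "'k::{alg_closed_field,field_char_0} \<Rightarrow> 'g::ab_group_add \<Rightarrow> 'g"
    and br :: "'g \<Rightarrow> 'g \<Rightarrow> 'g \<Rightarrow> 'g"
    and sv :: "'k \<Rightarrow> 'v::ab_group_add \<Rightarrow> 'v" +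
  fixes \<rho> :: "'g \<Rightarrow> 'g \<Rightarrow> 'v \<Rightarrow> 'v"
    and \<nu> :: "'g \<Rightarrow> 'v \<Rightarrow> 'v \<Rightarrow> 'v"
  assumes trilinear_rho: "trilinear sg sg sv sv \<rho>"
    and alternating_rho: "\<rho> x x w = 0"
    and trilinear_nu: "trilinear sg sv sv sv \<nu>"
    and alternating_nu: "\<nu> x v v = 0"
    and maurer_cartan:
      "let \<theta> = (\<lambda>X x. cochain1 (pi_ext br) X x + cochain1 (rho_bar \<rho>) X x
                     + cochain1 (nu_bar \<nu>) X x)
       in bracket_3Lie (module_prod.scale sg sv) 1 1 \<theta> \<theta> = (\<lambda>X x. 0)"

fun rho_nu_bracket ::
  "('g \<Rightarrow> 'g \<Rightarrow> 'g \<Rightarrow> 'g) \<Rightarrow> ('g \<Rightarrow> 'g \<Rightarrow> 'v \<Rightarrow> 'v) \<Rightarrow> ('g \<Rightarrow> 'v \<Rightarrow> 'v \<Rightarrow> 'v) \<Rightarrow>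
   'g \<times> 'v \<Rightarrow> 'g \<times> 'v \<Rightarrow> 'g \<times> 'v \<Rightarrow> 'g \<times> 'v::plus" where
  "rho_nu_bracket br \<rho> \<nu> (x, u) (y, v) (z, w) =
     (br x y z, \<rho> x y w + \<rho> y z u + \<rho> z x v + \<nu> x v w + \<nu> y w u + \<nu> z u v)"

end

theory Submission
  imports Defs
begin

text \<open>
  Write \<open>f\<close> for the bracket on \<open>\<gg> \<oplus> V\<close>. As a cochain of degree 1 it is the sum
  \<open>\<pi> + \<rho>\<close>-bar \<open>+ \<nu>\<close>-bar, so the equation defining a generalized representation reads
  \<open>[f, f] = 0\<close>. For two cochains of degree 1 the sums in \<open>f \<circ> f\<close> run over the three
  two-element subsets of \<open>{0, 1, 2}\<close>, and evaluated at \<open>a \<and> b\<close>, \<open>c \<and> d\<close>, \<open>x\<close> they give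
  \<open>f (f a b c) d x + f c (f a b d) x + f c d (f a b x) - f a b (f c d x)\<close>,
  the defect of the Fundamental Identity. The sign \<open>(-1)\<^sup>p\<^sup>q\<close> is \<open>- 1\<close> for \<open>p = q = 1\<close>, so that
  \<open>[f, f] = - 2 (f \<circ> f)\<close>. In characteristic 0 the factor can be cancelled: for any ternary
  operation \<open>f\<close> on a vector space, the Maurer--Cartan equation \<open>[f, f] = 0\<close> is the Fundamental
  Identity (\<open>maurer_cartan_iff_fundamental_identity\<close>).

  Trilinearity and skew-symmetry of \<open>f\<close> are inherited componentwise from \<open>br\<close>, \<open>\<rho>\<close> and \<open>\<nu>\<close>.
  Each of \<open>\<rho>\<close> and \<open>\<nu>\<close> enters \<open>f\<close> through a cyclic sum of maps that are skew in two of their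
  arguments, which makes the sum skew in all three.
\<close>

section \<open>Signs of the unshuffles of three letters\<close>

lemma sign_unshuffle_01: "sign (unshuffle 3 {0, 1}) = 1"
proof -
  have "unshuffle 3 {0, 1} = id"
  proof
    fix m :: nat
    have rest: "{..<3} - {0, 1} = {2::nat}"
      by auto
    consider "m \<ge> 3" | "m = 0" | "m = 1" | "m = 2"
      by linarith
    then show "unshuffle 3 {0, 1} m = id m"
      by cases (simp_all add: unshuffle_def rest[simplified])
  qed
  then show ?thesis
    by simp
qed

lemma sign_unshuffle_02: "sign (unshuffle 3 {0, 2}) = - 1"
proof -
  have "unshuffle 3 {0, 2} = transpose 1 2"
  proof
    fix m :: nat
    have rest: "{..<3} - {0, 2} = {1::nat}"
      by auto
    consider "m \<ge> 3" | "m = 0" | "m = 1" | "m = 2"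
      by linarith
    then show "unshuffle 3 {0, 2} m = transpose 1 2 m"
      by cases (simp_all add: unshuffle_def rest[simplified] transpose_def)
  qed
  then show ?thesis
    by (simp add: sign_swap_id)
qed

lemma sign_unshuffle_12: "sign (unshuffle 3 {1, 2}) = 1"
proof -
  have "unshuffle 3 {1, 2} = transpose 0 1 \<circ> transpose 1 2"
  proof
    fix m :: nat
    have rest: "{..<3} - {1, 2} = {0::nat}"
      by auto
    consider "m \<ge> 3" | "m = 0" | "m = 1" | "m = 2"
      by linarith
    then show "unshuffle 3 {1, 2} m = (transpose 0 1 \<circ> transpose 1 2) m"
      by cases (simp_all add: unshuffle_def rest[simplified] transpose_def)
  qed
  then show ?thesis
    by (simp add: sign_compose permutation_swap_id sign_swap_id)
qed


section \<open>The Maurer--Cartan equation and the Fundamental Identity\<close>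

text \<open>
  As a rewrite rule this evaluates the restriction of an explicitly listed set to a predicate.
\<close>

lemma restrict_insert:
  "{x \<in> insert a A. P x} = (if P a then insert a {x \<in> A. P x} else {x \<in> A. P x})"
  by auto

lemma two_subsets_of_three:
  "{J. J \<subseteq> {..2} \<and> card J = 2} = {{0, 1}, {0, 2}, {1, 2::nat}}"
proof -
  have "{..2} = {0, 1, 2::nat}"
    by auto
  then have "Pow {..2} = {{}, {2}, {1}, {1, 2}, {0}, {0, 2}, {0, 1}, {0, 1, 2::nat}}"
    by (simp only: Pow_insert Pow_empty image_insert image_empty Un_insert_left Un_empty_left)
  moreover have "card {0, 1::nat} = 2" "card {0, 2::nat} = 2" "card {1, 2::nat} = 2"
    "card {0, 1, 2::nat} = 3"
    by simp_all
  ultimately have "{J \<in> Pow {..2}. card J = 2} = {{1, 2}, {0, 2}, {0, 1::nat}}"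
    by (simp add: restrict_insert del: insert_iff Pow_iff)
  then show ?thesis
    by (simp add: insert_commute)
qed

text \<open>
  Each term belongs to one \<open>J = {j\<^sub>1 < j\<^sub>2}\<close>. For \<open>J = {0, 1}\<close> the inner cochain acts on the
  pair \<open>(c, d)\<close>, as a derivation, with sign \<open>+1\<close>. For \<open>J = {0, 2}\<close> and \<open>J = {1, 2}\<close> it acts on
  the last argument \<open>x\<close>; there the unshuffle has sign \<open>-1\<close> and \<open>+1\<close> respectively, and the factor
  \<open>(-1)\<^sup>p = -1\<close> reverses both.
\<close>

lemma (in vector_space) cochain_comp_1_1:
  "cochain_comp scale 1 1 \<alpha> \<beta> [(a, b), (c, d)] x =
     \<alpha> [(\<beta> [(a, b)] c, d)] x + \<alpha> [(c, \<beta> [(a, b)] d)] x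
     + \<alpha> [(c, d)] (\<beta> [(a, b)] x) - \<alpha> [(a, b)] (\<beta> [(c, d)] x)"
proof -
  have max: "Max {0, 1::nat} = 1" "Max {0, 2::nat} = 2" "Max {1, 2::nat} = 2"
    by auto
  have "{J. J \<subseteq> {..2} \<and> card J = 2 \<and> Q J} = {J \<in> {{0, 1}, {0, 2}, {1, 2}}. Q J}"
    for Q :: "nat set \<Rightarrow> bool"
    unfolding two_subsets_of_three[symmetric] by simp
  then have less: "{J. J \<subseteq> {..2::nat} \<and> card J = 2 \<and> Max J < 2} = {{0, 1}}"
    and eq: "{J. J \<subseteq> {..2::nat} \<and> card J = 2 \<and> Max J = 2} = {{0, 2}, {1, 2}}"
    by (simp_all add: restrict_insert max[simplified] del: insert_iff)
  have rest: "{..<2} - {0, Suc 0} = {}" "{..2} - {0, Suc 0} = {2}"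
    "{..2} - {0, 2} = {Suc 0}" "{..2} - {Suc 0, 2} = {0}"
    by auto
  \<comment> \<open>For \<open>J = {0, 1}\<close> the only index outside \<open>J\<close> is 2, which is not below \<open>Max J = 1\<close>, so
    \<open>k = 0\<close>; the simplifier reduces the set counted by \<open>k\<close> to the form below.\<close>
  have no_index: "{i. i = 2 \<and> i = (0::nat)} = {}"
    by auto
  have "{0, 2} \<noteq> {1, 2::nat}"
    by auto
  moreover have "{0, 2} - {2} = {0::nat}" "{1, 2} - {2} = {1::nat}" "{0, 1} - {1} = {0::nat}"
    by auto
  ultimately show ?thesis
    using sign_unshuffle_01 sign_unshuffle_02 sign_unshuffle_12
    by (simp add: cochain_comp_def less eq rest no_index max[simplified] Let_def algebra_simps
        flip: numeral_2_eq_2 numeral_3_eq_3)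
qed

lemma maurer_cartan_iff_fundamental_identity:
  fixes s :: "'k::field_char_0 \<Rightarrow> 'w::ab_group_add \<Rightarrow> 'w"
  assumes "vector_space s"
  shows "bracket_3Lie s 1 1 (cochain1 f) (cochain1 f) = (\<lambda>X x. 0) \<longleftrightarrow>
    (\<forall>a b c d x. f a b (f c d x) = f (f a b c) d x + f c (f a b d) x + f c d (f a b x))"
proof -
  interpret vector_space s
    by fact
  let ?C = "cochain_comp s 1 1 (cochain1 f) (cochain1 f)"
  have comp: "?C [(a, b), (c, d)] x =
      f (f a b c) d x + f c (f a b d) x + f c d (f a b x) - f a b (f c d x)" for a b c d x
    by (simp only: cochain_comp_1_1) (simp add: cochain1_def)
  \<comment> \<open>Both terms of the graded bracket equal \<open>- (f \<circ> f)\<close>, the first because of \<open>(-1)\<^sup>p\<^sup>q = -1\<close>.\<close>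
  have "bracket_3Lie s 1 1 (cochain1 f) (cochain1 f) X x = s (- 2) (?C X x)" for X x
    using scale_left_diff_distrib[of "- 1" 1 "?C X x"] by (simp add: bracket_3Lie_def)
  then have "bracket_3Lie s 1 1 (cochain1 f) (cochain1 f) = (\<lambda>X x. 0) \<longleftrightarrow> (\<forall>X x. ?C X x = 0)"
    by (simp add: fun_eq_iff)
  also have "\<dots> \<longleftrightarrow> (\<forall>a b c d x. ?C [(a, b), (c, d)] x = 0)"
  proof (intro iffI allI)
    fix X x
    assume *: "\<forall>a b c d x. ?C [(a, b), (c, d)] x = 0"
    show "?C X x = 0"
    proof (cases "length X = 2")
      case True
      then obtain a b c d where "X = [(a, b), (c, d)]"
        by (auto simp: length_Suc_conv numeral_2_eq_2)
      then show ?thesis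
        using * by blast
    qed (simp add: cochain_comp_def)
  qed blast
  also have "\<dots> \<longleftrightarrow>
      (\<forall>a b c d x. f a b (f c d x) = f (f a b c) d x + f c (f a b d) x + f c d (f a b x))"
    unfolding comp by (metis eq_iff_diff_eq_0)
  finally show ?thesis .
qed


section \<open>The bracket on the direct sum\<close>

lemma alternating_biadditive_imp_skew:
  fixes B :: "'a::plus \<Rightarrow> 'a \<Rightarrow> 'b::ab_group_add"
  assumes "\<And>x. B x x = 0"
    and add_left: "\<And>x y z. B (x + y) z = B x z + B y z"
    and add_right: "\<And>x y z. B x (y + z) = B x y + B x z"
  shows "B y x = - B x y"
proof -
  have "0 = B (x + y) (x + y)"
    by (simp add: assms(1))
  also have "\<dots> = B x y + B y x"
    by (simp only: add_left add_right) (simp add: assms(1))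
  finally show ?thesis
    by (metis add_eq_0_iff)
qed

context generalized_representation
begin

sublocale W: vector_space_prod sg sv
  by unfold_locales

lemma br_linear:
  "br (x + x') y z = br x y z + br x' y z" "br x (y + y') z = br x y z + br x y' z"
  "br x y (z + z') = br x y z + br x y z'"
  "br (sg c x) y z = sg c (br x y z)" "br x (sg c y) z = sg c (br x y z)"
  "br x y (sg c z) = sg c (br x y z)"
  using g.trilinear_bracket by (simp_all add: trilinear_def Vector_Spaces.linear_iff)

lemma rho_linear:
  "\<rho> (x + x') y w = \<rho> x y w + \<rho> x' y w" "\<rho> x (y + y') w = \<rho> x y w + \<rho> x y' w"
  "\<rho> x y (w + w') = \<rho> x y w + \<rho> x y w'"
  "\<rho> (sg c x) y w = sv c (\<rho> x y w)" "\<rho> x (sg c y) w = sv c (\<rho> x y w)"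
  "\<rho> x y (sv c w) = sv c (\<rho> x y w)"
  using trilinear_rho by (simp_all add: trilinear_def Vector_Spaces.linear_iff)

lemma nu_linear:
  "\<nu> (x + x') v w = \<nu> x v w + \<nu> x' v w" "\<nu> x (v + v') w = \<nu> x v w + \<nu> x v' w"
  "\<nu> x v (w + w') = \<nu> x v w + \<nu> x v w'"
  "\<nu> (sg c x) v w = sv c (\<nu> x v w)" "\<nu> x (sv c v) w = sv c (\<nu> x v w)"
  "\<nu> x v (sv c w) = sv c (\<nu> x v w)"
  using trilinear_nu by (simp_all add: trilinear_def Vector_Spaces.linear_iff)

lemma rho_skew: "\<rho> y x w = - \<rho> x y w"
  by (rule alternating_biadditive_imp_skew) (simp_all add: alternating_rho rho_linear)

lemma nu_skew: "\<nu> x w v = - \<nu> x v w"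
  by (rule alternating_biadditive_imp_skew) (simp_all add: alternating_nu nu_linear)

lemma trilinear_rho_nu_bracket:
  "trilinear W.scale W.scale W.scale W.scale (rho_nu_bracket br \<rho> \<nu>)"
  unfolding trilinear_def Vector_Spaces.linear_iff
  by (auto simp: W.scale_prod W.p.vector_space_axioms br_linear rho_linear nu_linear
      V.scale_right_distrib)

lemma rho_nu_bracket_skew_12: "rho_nu_bracket br \<rho> \<nu> b a c = - rho_nu_bracket br \<rho> \<nu> a b c"
proof (cases a; cases b; cases c)
  fix x u y v z w
  assume "a = (x, u)" "b = (y, v)" "c = (z, w)"
  then show ?thesis
    using g.skew_12[of y x z] rho_skew[of y x w] rho_skew[of x z v] rho_skew[of z y u]
      nu_skew[of x w v] nu_skew[of y u w] nu_skew[of z v u]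
    by simp
qed

lemma rho_nu_bracket_skew_23: "rho_nu_bracket br \<rho> \<nu> a c b = - rho_nu_bracket br \<rho> \<nu> a b c"
proof (cases a; cases b; cases c)
  fix x u y v z w
  assume "a = (x, u)" "b = (y, v)" "c = (z, w)"
  then show ?thesis
    using g.skew_23[of x z y] rho_skew[of y x w] rho_skew[of x z v] rho_skew[of z y u]
      nu_skew[of x w v] nu_skew[of y u w] nu_skew[of z v u]
    by simp
qed

lemma cochain1_rho_nu_bracket:
  "cochain1 (rho_nu_bracket br \<rho> \<nu>) =
     (\<lambda>X x. cochain1 (pi_ext br) X x + cochain1 (rho_bar \<rho>) X x + cochain1 (nu_bar \<nu>) X x)"
  by (auto simp: fun_eq_iff cochain1_def algebra_simps split: list.split)

lemma three_lie_algebra_rho_nu_bracket: "three_lie_algebra W.scale (rho_nu_bracket br \<rho> \<nu>)"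
proof -
  have "bracket_3Lie W.scale 1 1 (cochain1 (rho_nu_bracket br \<rho> \<nu>))
      (cochain1 (rho_nu_bracket br \<rho> \<nu>)) = (\<lambda>X x. 0)"
    using maurer_cartan by (simp add: cochain1_rho_nu_bracket Let_def)
  note FI = this[unfolded maurer_cartan_iff_fundamental_identity[OF W.p.vector_space_axioms],
      rule_format]
  show ?thesis
    by unfold_locales
      (fact trilinear_rho_nu_bracket rho_nu_bracket_skew_12 rho_nu_bracket_skew_23 FI)+
qed

end

theorem theorem3p4:
  fixes sg :: "'k::{alg_closed_field,field_char_0} \<Rightarrow> 'g::ab_group_add \<Rightarrow> 'g"
    and br :: "'g \<Rightarrow> 'g \<Rightarrow> 'g \<Rightarrow> 'g"
    and sv :: "'k \<Rightarrow> 'v::ab_group_add \<Rightarrow> 'v"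
    and \<rho> :: "'g \<Rightarrow> 'g \<Rightarrow> 'v \<Rightarrow> 'v"
    and \<nu> :: "'g \<Rightarrow> 'v \<Rightarrow> 'v \<Rightarrow> 'v"
  assumes "three_lie_algebra sg br"
    and "generalized_representation sg br sv \<rho> \<nu>"
  shows "three_lie_algebra (module_prod.scale sg sv) (rho_nu_bracket br \<rho> \<nu>)"
  using assms(2) by (rule generalized_representation.three_lie_algebra_rho_nu_bracket)

end
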